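(* Let $\lambda,\alpha>0$ and let $k\ge1$ be an integer. Let $$\psi^{el}_{k,\alpha}(t)=\Pr\{B^{el}_\alpha(t)<G\}=1-\left(\frac{\lambda\sqrt t}{\sqrt2}\right)^k\sum_{l=0}^\infty\left(-\frac{\alpha\sqrt t}{\sqrt2}\right)^lE^k_{\frac12,\frac{l+k}2+1}\left(-\frac{\lambda\sqrt t}{\sqrt2}\right),\qquad t>0,$$ be the crossing probability of a Gamma random variable $G$ with parameters $\lambda,k$ by an independent elastic Brownian motion $B^{el}_\alpha$ with absorbing rate $\alpha$. Then $\psi^{el}_{k,\alpha}$ satisfies, for $t>0$, the fractional equation $$\sum_{j=0}^k\binom kj\left(\frac{\sqrt2}{\lambda}\right)^j\frac{d^{\frac j2+\frac12}}{dt^{\frac j2+\frac12}}\psi^{el}_{k,\alpha}+\frac{\alpha}{\sqrt2}\sum_{j=1}^k\binom kj\left(\frac{\sqrt2}{\lambda}\right)^j\frac{d^{\frac j2}}{dt^{\frac j2}}\psi^{el}_{k,\alpha}=\frac{\alpha}{\sqrt2}\left(1-\psi^{el}_{k,\alpha}\right)-\frac{c_k}{\sqrt{\pi t}},$$ where $c_k=1$ for $k$ odd and $c_k=0$ for $k$ even. The initial conditions are $\psi^{el}_{k,\alpha}(0)=1$ for any $k\ge1$ and $$\left.\frac{d^r}{dt^r}\psi^{el}_{k,\alpha}(t)\right|_{t=0}=0,\quad r=1,\dots,\tfrac{k-1}2,\ \text{for odd }k>1,$$ $$\left.\frac{d^r}{dt^r}\psi^{el}_{k,\alpha}(t)\right|_{t=0}=0,\quad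 r=1,\dots,\tfrac k2-1,\ \text{for even }k>1.$$
   Context: The generalized Mittag-Leffler function is $E^\gamma_{\alpha,\beta}(z)=\sum_{j=0}^\infty\frac{(\gamma)_j\,z^j}{j!\,\Gamma(\alpha j+\beta)}$, with $(\gamma)_0=1$, $(\gamma)_j=\gamma(\gamma+1)\cdots(\gamma+j-1)$. $\frac{d^\nu}{dt^\nu}$ is the Caputo derivative: for $m-1<\nu<m$, $m\in\mathbb{N}$, $\frac{d^\nu}{dt^\nu}u(t)=\frac{1}{\Gamma(m-\nu)}\int_0^t\frac{1}{(t-s)^{1+\nu-m}}\frac{d^m}{ds^m}u(s)\,ds$, and $\frac{d^\nu}{dt^\nu}u=\frac{d^m}{dt^m}u$ for $\nu=m$. Values at $t=0$ are limits $t\to0^+$. For the probabilistic meaning: $G$ has density $\frac{\lambda^k}{\Gamma(k)}e^{-\lambda z}z^{k-1}$, $z>0$, and the elastic Brownian motion $B^{el}_\alpha(t)$ is a process on $[0,\infty)$ with one-dimensional law $$q^{el}_\alpha(s,t)=2e^{\alpha s}\int_s^{+\infty}we^{-\alpha w}\frac{e^{-\frac{w^2}{2t}}}{\sqrt{2\pi t^3}}\,dw+q_\alpha(t)\,\delta(s),\qquad q_\alpha(t)=1-2e^{\frac{\alpha^2t}{2}}\int_{\alpha\sqrt t}^{+\infty}\frac{e^{-w^2/2}}{\sqrt{2\pi}}\,dw,$$ $\delta$ being the Dirac mass at $0$. That the crossing probability equals the displayed series is a separate result and may be taken as the definition of $\psi^{el}_{k,\alpha}$ here. *)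

theory Defs
  imports "HOL-Analysis.Analysis"
begin

definition mittag_leffler :: "real \<Rightarrow> real \<Rightarrow> real \<Rightarrow> real \<Rightarrow> real" where
  "mittag_leffler \<gamma> \<alpha> \<beta> z =
     (\<Sum>j. pochhammer \<gamma> j * z ^ j / (fact j * Gamma (\<alpha> * real j + \<beta>)))"

text \<open>
  The Caputo derivative of order \<open>\<nu> > 0\<close> at \<open>t > 0\<close>, where \<open>m = \<lceil>\<nu>\<rceil>\<close>.
  The values of \<open>caputo\<close> are meaningful only where \<open>caputo_differentiable\<close> holds, that is,
  where the ordinary derivatives involved exist and the integral converges absolutely.
\<close>

definition caputo_integrand :: "real \<Rightarrow> (real \<Rightarrow> real) \<Rightarrow> real \<Rightarrow> real \<Rightarrow> real" where
  "caputo_integrand \<nu> u t s =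
     (let m = nat \<lceil>\<nu>\<rceil> in 1 / (t - s) powr (1 + \<nu> - real m) * (deriv ^^ m) u s)"

definition caputo :: "real \<Rightarrow> (real \<Rightarrow> real) \<Rightarrow> real \<Rightarrow> real" where
  "caputo \<nu> u t =
     (let m = nat \<lceil>\<nu>\<rceil> in
        if \<nu> = real m then (deriv ^^ m) u t
        else 1 / Gamma (real m - \<nu>) * (LBINT s:{0<..<t}. caputo_integrand \<nu> u t s))"

definition caputo_differentiable :: "real \<Rightarrow> (real \<Rightarrow> real) \<Rightarrow> real \<Rightarrow> bool" where
  "caputo_differentiable \<nu> u t \<longleftrightarrow>
     (let m = nat \<lceil>\<nu>\<rceil> in
        (\<forall>r<m. \<forall>s\<in>{0<..t}. (deriv ^^ r) u differentiable (at s)) \<and>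
        (\<nu> \<noteq> real m \<longrightarrow> set_integrable lborel {0<..<t} (caputo_integrand \<nu> u t)))"

text \<open>
  The crossing probability \<open>Pr {B(t) < G}\<close>, for \<open>t > 0\<close>, of a Gamma random variable \<open>G\<close> with
  parameters \<open>lam\<close> and \<open>k\<close> by an independent elastic Brownian motion \<open>B\<close> with absorbing
  rate \<open>\<alpha>\<close>, given by its explicit series.
\<close>

definition psi_el :: "real \<Rightarrow> real \<Rightarrow> nat \<Rightarrow> real \<Rightarrow> real" where
  "psi_el lam \<alpha> k t =
     1 - (lam * sqrt t / sqrt 2) ^ k *
         (\<Sum>l. (- (\<alpha> * sqrt t / sqrt 2)) ^ l *
              mittag_leffler (real k) (1 / 2) (real (l + k) / 2 + 1) (- (lam * sqrt t / sqrt 2)))"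

end

theory Submission
  imports Defs
begin

text \<open>
  On series in \<open>t\<^sup>n\<^sup>/\<^sup>2 / \<Gamma>(n/2 + 1)\<close> the Caputo derivative of order \<open>1/2\<close> acts as the
  backward shift of the coefficient sequence, so such a series is encoded by the formal power series
  \<open>P(X)\<close> of its coefficients. With \<open>a = \<alpha>/\<surd>2\<close> and \<open>m = \<lambda>/\<surd>2\<close>, summing over antidiagonals shows
  that the crossing probability has \<open>P = 1 - (mX)\<^sup>k / ((1 + aX)(1 + mX)\<^sup>k)\<close>, and the fractional
  equation becomes an identity of formal power series, by the binomial theorem applied to
  \<open>(1 + mX)\<^sup>k\<close>. The term \<open>c\<^sub>k / \<surd>(\<pi> t)\<close> is the only deviation from the shift: the derivative
  of order \<open>(k + 1)/2\<close> maps \<open>t\<^sup>k\<^sup>/\<^sup>2\<close> to a multiple of \<open>t\<close> to the power \<open>-1/2\<close> if \<open>k\<close> is odd, whereas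
  for even \<open>k\<close> this monomial is a polynomial that is killed by the inner derivative.
\<close>

section \<open>Convergence of power series weighted by reciprocal Gamma values\<close>

text \<open>The functional equation of \<open>rGamma\<close> relates arguments that differ by 1,
  hence indices that differ by 2; the ratio of two such terms is of the order
  \<open>y^2 / n\<close>. Even and odd indices are therefore compared with one geometric series by
  an induction with step 2.\<close>

lemma summable_rGamma_half_power:
  fixes q y :: real
  assumes y: "y \<ge> 0"
  shows "summable (\<lambda>n. \<bar>rGamma (real n / 2 + q)\<bar> * y ^ n)"
proof -
  define f where "f n = \<bar>rGamma (real n / 2 + q)\<bar> * y ^ n" for n
  \<comment> \<open>Beyond \<open>N\<close> the argument \<open>z = n / 2 + q\<close> is at least
    \<open>4 * y^2 + 1\<close>, so it is positive and the ratio is at most 1/4.\<close>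
  define N where "N = nat \<lceil>2 * (\<bar>q\<bar> + 4 * y\<^sup>2 + 1)\<rceil>"
  have step: "f (n + 2) \<le> f n / 4" if "n \<ge> N" for n
  proof -
    define z where "z = real n / 2 + q"
    have "2 * (\<bar>q\<bar> + 4 * y\<^sup>2 + 1) \<le> real n"
      using that unfolding N_def by linarith
    hence z: "z \<ge> 4 * y\<^sup>2 + 1" unfolding z_def by (simp add: abs_if split: if_splits)
    have zpos: "z > 0" using z by (smt (verit) zero_le_power2)
    have eq: "real (n + 2) / 2 + q = z + 1" by (simp add: z_def)
    have "f n = z * \<bar>rGamma (z + 1)\<bar> * y ^ n"
      unfolding f_def z_def[symmetric] rGamma_plus1[of z, symmetric] using zpos
      by (simp add: abs_mult)
    also have "\<dots> \<ge> (4 * y\<^sup>2) * \<bar>rGamma (z + 1)\<bar> * y ^ n"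
      using z y by (intro mult_right_mono) auto
    finally show ?thesis
      unfolding f_def eq by (simp add: power_add power2_eq_square mult_ac)
  qed
  have f0: "f n \<ge> 0" for n using y by (simp add: f_def)
  \<comment> \<open>\<open>K\<close> covers both base cases of the induction; the factor 2 makes up
    for \<open>(1 / 2) ^ 1\<close>.\<close>
  define K where "K = max (f N) (2 * f (Suc N))"
  have bound: "f (N + n) \<le> K * (1 / 2) ^ n" for n
  proof (induction n rule: less_induct)
    case (less n)
    consider "n = 0" | "n = 1" | m where "n = m + 2"
      by (metis One_nat_def add_2_eq_Suc' not0_implies_Suc)
    thus ?case
    proof cases
      case (3 m)
      have "f (N + n) \<le> f (N + m) / 4" using step[of "N + m"] 3 by (simp add: add_ac)
      also have "\<dots> \<le> K * (1 / 2) ^ m / 4" using less.IH[of m] 3 by simp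
      also have "\<dots> = K * (1 / 2) ^ n" using 3 by (simp add: power_add power2_eq_square)
      finally show ?thesis .
    qed (auto simp: K_def)
  qed
  have "summable (\<lambda>n. f (n + N))"
    by (rule summable_comparison_test'[of "\<lambda>n. K * (1 / 2) ^ n" 0])
       (use bound f0 in \<open>auto intro!: summable_mult summable_geometric simp: add_ac\<close>)
  hence "summable f" by (subst (asm) summable_iff_shift)
  thus ?thesis by (simp add: f_def[abs_def])
qed

text \<open>A positive radius bounds the coefficients by \<open>M / r ^ n\<close>, and geometric
  growth is beaten by the reciprocal Gamma factor. Hence convergence holds for every
  \<open>x\<close>, however small the radius.\<close>

lemma summable_fps_rGamma_half:
  fixes C :: "real fps"
  assumes "fps_conv_radius C > 0"
  shows "summable (\<lambda>n. \<bar>fps_nth C n * rGamma (real n / 2 + q) * x ^ n\<bar>)"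
proof -
  obtain r where r: "r > 0" "ereal r < fps_conv_radius C"
    using assms by (metis ereal_dense2 ereal_less(2) zero_ereal_def)
  have "summable (\<lambda>n. fps_nth C n * r ^ n)"
    using r by (intro summable_in_conv_radius) (auto simp: fps_conv_radius_def)
  hence "Bseq (\<lambda>n. fps_nth C n * r ^ n)"
    by (intro convergent_imp_Bseq) (auto intro: summable_LIMSEQ_zero simp: convergent_def)
  then obtain M where M: "M > 0" "\<And>n. \<bar>fps_nth C n * r ^ n\<bar> \<le> M"
    by (auto elim!: BseqE)
  show ?thesis
  proof (rule summable_comparison_test')
    show "summable (\<lambda>n. M * (\<bar>rGamma (real n / 2 + q)\<bar> * (\<bar>x\<bar> / r) ^ n))"
      using r by (intro summable_mult summable_rGamma_half_power) auto
    show "norm \<bar>fps_nth C n * rGamma (real n / 2 + q) * x ^ n\<bar>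
        \<le> M * (\<bar>rGamma (real n / 2 + q)\<bar> * (\<bar>x\<bar> / r) ^ n)" if "n \<ge> 0" for n
    proof -
      have "\<bar>fps_nth C n * rGamma (real n / 2 + q) * x ^ n\<bar>
          = \<bar>fps_nth C n * r ^ n\<bar> * (\<bar>rGamma (real n / 2 + q)\<bar> * (\<bar>x\<bar> / r) ^ n)"
        using r by (simp add: abs_mult power_divide power_abs)
      also have "\<dots> \<le> M * (\<bar>rGamma (real n / 2 + q)\<bar> * (\<bar>x\<bar> / r) ^ n)"
        using r by (intro mult_right_mono M) auto
      finally show ?thesis by simp
    qed
  qed
qed

section \<open>Series in half-integer powers: differentiation, shift and limit at 0\<close>

text \<open>
  Since \<open>rGamma\<close> vanishes at the non-positive integers, the derivative of order \<open>r\<close> turns \<open>p\<close> into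
  \<open>p - r\<close> without exception, also for negative \<open>p\<close>.
\<close>

definition half_series :: "real fps \<Rightarrow> real \<Rightarrow> real \<Rightarrow> real" where
  "half_series C p t =
     (\<Sum>n. fps_nth C n * rGamma (real n / 2 + p + 1) * t powr (real n / 2 + p))"

lemma powr_half_nat_add:
  fixes t p :: real
  assumes "t > 0"
  shows "t powr (real n / 2 + p) = t powr p * sqrt t ^ n"
proof -
  have "sqrt t ^ n = t powr (real n / 2)"
    using assms by (simp add: powr_half_sqrt[symmetric] powr_realpow[symmetric] powr_powr)
  thus ?thesis by (simp add: powr_add)
qed

lemma summable_half_series:
  assumes "fps_conv_radius C > 0" "t > 0"
  shows "summable (\<lambda>n. \<bar>fps_nth C n * rGamma (real n / 2 + p + 1) * t powr (real n / 2 + p)\<bar>)"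
proof -
  have "summable (\<lambda>n. t powr p * \<bar>fps_nth C n * rGamma (real n / 2 + (p + 1)) * sqrt t ^ n\<bar>)"
    by (intro summable_mult summable_fps_rGamma_half assms)
  thus ?thesis
    unfolding powr_half_nat_add[OF assms(2)] using assms(2) by (simp add: abs_mult mult_ac add_ac)
qed

lemma half_series_sums:
  assumes "fps_conv_radius C > 0" "t > 0"
  shows "(\<lambda>n. fps_nth C n * rGamma (real n / 2 + p + 1) * t powr (real n / 2 + p))
           sums half_series C p t"
  unfolding half_series_def
  by (rule summable_sums, rule summable_rabs_cancel, rule summable_half_series[OF assms])

lemma half_series_eq_power_series:
  assumes "fps_conv_radius C > 0" "t > 0"
  shows "half_series C p t =
           t powr p * (\<Sum>n. fps_nth C n * rGamma (real n / 2 + p + 1) * sqrt t ^ n)"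
proof -
  have "summable (\<lambda>n. fps_nth C n * rGamma (real n / 2 + p + 1) * sqrt t ^ n)"
    using summable_rabs_cancel[OF summable_fps_rGamma_half[OF assms(1), of "p + 1" "sqrt t"]]
    by (simp add: add_ac)
  thus ?thesis
    unfolding half_series_def powr_half_nat_add[OF assms(2)]
    by (subst suminf_mult[symmetric]) (auto simp: mult_ac)
qed

text \<open>The factor \<open>n / 2 + p\<close> produced by differentiating a power is absorbed by
  the functional equation of \<open>rGamma\<close>. Termwise differentiation is justified by writing
  the series as \<open>t powr p * G (sqrt t)\<close> with \<open>G\<close> an everywhere convergent
  power series.\<close>

lemma DERIV_half_series:
  assumes C: "fps_conv_radius C > 0" and t: "t > 0"
  shows "(half_series C p has_real_derivative half_series C (p - 1) t) (at t)"
proof -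
  define c where "c n = fps_nth C n * rGamma (real n / 2 + p + 1)" for n
  define G where "G x = (\<Sum>n. c n * x ^ n)" for x
  define G' where "G' x = (\<Sum>n. diffs c n * x ^ n)" for x
  define x where "x = sqrt t"
  have x: "x > 0" "x * x = t" "x\<^sup>2 = t" using t by (simp_all add: x_def)
  have sc: "summable (\<lambda>n. c n * y ^ n)" for y
    using summable_rabs_cancel[OF summable_fps_rGamma_half[OF C, of "p + 1" y]]
    by (simp add: c_def add_ac)
  have dG: "(G has_real_derivative G' y) (at y)" for y
    unfolding G_def[abs_def] G'_def by (rule termdiffs_strong_converges_everywhere[OF sc])
  have "(\<lambda>n. diffs c n * x ^ n) sums G' x"
    unfolding G'_def by (rule summable_sums, rule termdiff_converges_all[OF sc])
  hence "(\<lambda>n. real (Suc n) * c (Suc n) * x ^ n) sums G' x"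
    by (simp add: diffs_def)
  hence "(\<lambda>n. x * (real (Suc n) * c (Suc n) * x ^ n)) sums (x * G' x)"
    by (rule sums_mult)
  hence "(\<lambda>n. (\<lambda>n. real n * c n * x ^ n) (Suc n)) sums (x * G' x)"
    by (simp add: mult_ac)
  hence s1: "(\<lambda>n. real n * c n * x ^ n) sums (x * G' x)"
    by (subst (asm) sums_Suc_iff) simp
  have s2: "(\<lambda>n. c n * x ^ n) sums G x"
    unfolding G_def by (rule summable_sums[OF sc])
  \<comment> \<open>The right-hand side is what the product and chain rules give for
    \<open>t powr p * G (sqrt t)\<close>, with \<open>x = sqrt t\<close>.\<close>
  have "(\<lambda>n. t powr (p - 1) * (p * (c n * x ^ n) + (1/2) * (real n * c n * x ^ n)))
          sums (t powr (p - 1) * (p * G x + (1/2) * (x * G' x)))"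
    by (intro sums_mult sums_add s1 s2)
  moreover have "t powr (p - 1) * (p * (c n * x ^ n) + (1/2) * (real n * c n * x ^ n))
      = fps_nth C n * rGamma (real n / 2 + (p - 1) + 1) * t powr (real n / 2 + (p - 1))" for n
  proof -
    have "rGamma (real n / 2 + (p - 1) + 1) = (real n / 2 + p) * rGamma (real n / 2 + p + 1)"
      using rGamma_plus1[of "real n / 2 + p"] by (simp add: add_ac)
    thus ?thesis
      unfolding powr_half_nat_add[OF t] x_def[symmetric] c_def by (simp add: algebra_simps)
  qed
  ultimately have "(\<lambda>n. fps_nth C n * rGamma (real n / 2 + (p - 1) + 1) *
        t powr (real n / 2 + (p - 1))) sums (t powr (p - 1) * (p * G x + (1/2) * (x * G' x)))"
    by simp
  hence val: "half_series C (p - 1) t = t powr (p - 1) * (p * G x + (1/2) * (x * G' x))"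
    using half_series_sums[OF C t, of "p - 1"] by (rule sums_unique2[rotated])
  have "((\<lambda>t. t powr p * G (sqrt t)) has_real_derivative
          (p * t powr (p - 1)) * G x + G' x * (inverse x / 2) * t powr p) (at t)"
    using t unfolding x_def
    by (intro DERIV_mult DERIV_chain2[OF dG] DERIV_real_sqrt has_real_derivative_powr)
  also have "(p * t powr (p - 1)) * G x + G' x * (inverse x / 2) * t powr p = half_series C (p - 1) t"
  proof -
    have "t powr p = t powr (p - 1) * (x * x)"
      using t x by (simp add: powr_diff)
    thus ?thesis unfolding val using x by (simp add: field_simps)
  qed
  finally show ?thesis
  proof (rule DERIV_cong_ev[THEN iffD1, rotated -1, OF _ refl _ refl])
    show "\<forall>\<^sub>F y in nhds t. y powr p * G (sqrt y) = half_series C p y"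
      using eventually_nhds_in_open[of "{0<..}" t] t
      by (auto elim!: eventually_mono simp: half_series_eq_power_series[OF C] G_def c_def)
  qed
qed

text \<open>Moving the index by \<open>d\<close> and the exponent by \<open>d / 2\<close> leaves
  each remaining term unchanged. A dropped term may vanish through its coefficient or through a pole
  of Gamma; the latter happens for polynomials killed by differentiation.\<close>

lemma half_series_shift:
  assumes C: "fps_conv_radius C > 0" and t: "t > 0"
    and z: "\<And>n. n < d \<Longrightarrow> fps_nth C n * rGamma (real n / 2 + p + 1) = 0"
  shows "half_series C p t = half_series (fps_shift d C) (p + real d / 2) t"
proof -
  have "(\<Sum>n<d. fps_nth C n * rGamma (real n / 2 + p + 1) * t powr (real n / 2 + p)) = 0"
    by (intro sum.neutral ballI) (simp add: z del: mult_eq_0_iff)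
  thus ?thesis
    using suminf_split_initial_segment[OF sums_summable[OF half_series_sums[OF C t, of p]], of d]
    unfolding half_series_def by (simp add: add_divide_distrib add_ac)
qed

lemma tendsto_half_series_0:
  assumes C: "fps_conv_radius C > 0" and p: "p \<ge> 0"
  shows "(half_series C p \<longlongrightarrow> (if p = 0 then fps_nth C 0 else 0)) (at_right 0)"
proof -
  define G where "G x = (\<Sum>n. (fps_nth C n * rGamma (real n / 2 + p + 1)) * x ^ n)" for x
  have sc: "summable (\<lambda>n. (fps_nth C n * rGamma (real n / 2 + p + 1)) * y ^ n)" for y
    using summable_rabs_cancel[OF summable_fps_rGamma_half[OF C, of "p + 1" y]]
    by (simp add: add_ac)
  have "isCont G 0"
    unfolding G_def[abs_def] by (rule DERIV_isCont[OF termdiffs_strong_converges_everywhere[OF sc]])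
  moreover have "(sqrt \<longlongrightarrow> 0) (at_right 0)"
    using tendsto_real_sqrt[of "\<lambda>x. x" 0 "at_right 0"] by (simp add: tendsto_ident_at)
  ultimately have GL: "((\<lambda>t. G (sqrt t)) \<longlongrightarrow> G 0) (at_right 0)"
    by (rule isCont_tendsto_compose)
  have G0: "G 0 = fps_nth C 0 * rGamma (p + 1)"
    unfolding G_def by (simp add: powser_zero)
  have ev: "\<forall>\<^sub>F t in at_right 0. t powr p * G (sqrt t) = half_series C p t"
    by (rule eventually_at_right_less[THEN eventually_mono])
       (simp add: half_series_eq_power_series[OF C] G_def)
  have "((\<lambda>t. t powr p * G (sqrt t)) \<longlongrightarrow> (if p = 0 then fps_nth C 0 else 0)) (at_right 0)"
  \<comment> \<open>In the case \<open>p = 0\<close> the limit of \<open>t powr p\<close> is 1,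
    whereas \<open>0 powr 0 = 0\<close>.\<close>
  proof (cases "p = 0")
    case True
    have "\<forall>\<^sub>F t in at_right 0. G (sqrt t) = t powr p * G (sqrt t)"
      by (rule eventually_at_right_less[THEN eventually_mono]) (simp add: True)
    from Lim_transform_eventually[OF GL this] show ?thesis
      using True G0 by (simp add: rGamma_inverse_Gamma)
  next
    case False
    have "((\<lambda>t. t powr p) \<longlongrightarrow> 0 powr p) (at_right 0)"
      using p False by (intro tendsto_powr2 tendsto_const tendsto_ident_at)
        (auto simp: eventually_at_right_less eventually_mono[OF eventually_at_right_less])
    from tendsto_mult[OF this GL] show ?thesis using False by simp
  qed
  thus ?thesis by (rule Lim_transform_eventually[OF _ ev])
qed

section \<open>Fractional integration of half-integer power series\<close>

text \<open>Euler's Beta integral on the unit interval, rescaled by the substitution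
  \<open>s / t\<close>.\<close>

lemma has_bochner_integral_Beta:
  fixes a b t :: real
  assumes a: "a > 0" and b: "b > 0" and t: "t > 0"
  shows "has_bochner_integral lborel
           (\<lambda>s. indicator {0<..<t} s * ((t - s) powr (a - 1) * s powr (b - 1)))
           (Beta a b * t powr (a + b - 1))"
proof -
  let ?g = "\<lambda>s::real. s powr (b - 1) * (1 - s) powr (a - 1)"
  have hi: "(?g has_integral Beta a b) {0<..<1}"
    using has_integral_Beta_real[OF b a] by (simp add: has_integral_Icc_iff_Ioo Beta_commute)
  \<comment> \<open>Nonnegativity makes the gauge integral absolutely convergent, and Borel
    measurability then carries it over to \<open>lborel\<close>.\<close>
  have "?g absolutely_integrable_on {0<..<1}"
    by (rule nonnegative_absolutely_integrable_1)
       (use hi in \<open>auto simp: has_integral_iff\<close>)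
  hence si: "set_integrable lborel {0<..<1} ?g"
    unfolding set_integrable_def by (subst (asm) integrable_completion) auto
  have "(LBINT s:{0<..<1}. ?g s) = Beta a b"
    using set_borel_integral_eq_integral(2)[OF si] hi by (simp add: integral_unique)
  hence "has_bochner_integral lborel (\<lambda>s. indicator {0<..<1} s * ?g s) (Beta a b)"
    using si by (simp add: has_bochner_integral_iff set_integrable_def set_lebesgue_integral_def)
  hence "has_bochner_integral lborel
      (\<lambda>s. indicator {0<..<1} (0 + (1/t) * s) * ?g (0 + (1/t) * s)) (Beta a b /\<^sub>R \<bar>1/t\<bar>)"
    using t by (subst (asm) lborel_has_bochner_integral_real_affine_iff[of "1/t" _ _ 0]) auto
  hence "has_bochner_integral lborel
      (\<lambda>s. t powr (a + b - 2) * (indicator {0<..<1} (0 + (1/t) * s) * ?g (0 + (1/t) * s)))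
      (t powr (a + b - 2) * (Beta a b /\<^sub>R \<bar>1/t\<bar>))"
    by (rule has_bochner_integral_mult_right)
  also have "(\<lambda>s. t powr (a + b - 2) * (indicator {0<..<1} (0 + (1/t) * s) * ?g (0 + (1/t) * s)))
      = (\<lambda>s. indicator {0<..<t} s * ((t - s) powr (a - 1) * s powr (b - 1)))"
  proof
    fix s :: real
    show "t powr (a + b - 2) * (indicator {0<..<1} (0 + (1/t) * s) * ?g (0 + (1/t) * s))
      = indicator {0<..<t} s * ((t - s) powr (a - 1) * s powr (b - 1))"
    proof (cases "s \<in> {0<..<t}")
      case True
      have "?g (s / t) = (s powr (b - 1) / t powr (b - 1)) * ((t - s) powr (a - 1) / t powr (a - 1))"
        using True t by (simp add: powr_divide[symmetric] diff_divide_distrib)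
      moreover have "t powr (a + b - 2) = t powr (a - 1) * t powr (b - 1)"
        by (simp add: powr_add[symmetric])
      ultimately show ?thesis using True t by simp
    next
      case False
      thus ?thesis using t by (auto simp: indicator_def field_simps)
    qed
  qed
  also have "t powr (a + b - 2) * (Beta a b /\<^sub>R \<bar>1/t\<bar>) = Beta a b * t powr (a + b - 1)"
    using t powr_mult_base[of t "a + b - 2"] by (simp add: mult_ac)
  finally show ?thesis .
qed

text \<open>Up to the factor \<open>Gamma a\<close> this is the Riemann-Liouville integral of order
  \<open>a\<close>: in each term the Beta value replaces one reciprocal Gamma factor by the next,
  raising the exponent by \<open>a\<close>. The bound on \<open>p\<close> makes every power
  integrable at 0.\<close>

lemma has_bochner_integral_half_series:
  fixes t a p :: real
  assumes C: "fps_conv_radius C > 0" and t: "t > 0" and a: "a > 0" and p: "p > -1"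
  shows "has_bochner_integral lborel
           (\<lambda>s. indicator {0<..<t} s * ((t - s) powr (a - 1) * half_series C p s))
           (Gamma a * half_series C (p + a) t)"
proof -
  define f where "f n s = (fps_nth C n * rGamma (real n / 2 + p + 1)) *
      (indicator {0<..<t} s * ((t - s) powr (a - 1) * s powr (real n / 2 + p)))" for n s
  define v where "v n = rGamma (real n / 2 + p + 1) * (Beta a (real n / 2 + p + 1) *
      t powr (a + (real n / 2 + p)))" for n
  have B: "has_bochner_integral lborel
      (\<lambda>s. indicator {0<..<t} s * ((t - s) powr (a - 1) * s powr (real n / 2 + p)))
      (Beta a (real n / 2 + p + 1) * t powr (a + (real n / 2 + p)))" for n
    using has_bochner_integral_Beta[OF a _ t, of "real n / 2 + p + 1"] p by (simp add: algebra_simps)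
  have Bc: "has_bochner_integral lborel
      (\<lambda>s. c * (indicator {0<..<t} s * ((t - s) powr (a - 1) * s powr (real n / 2 + p))))
      (c * (Beta a (real n / 2 + p + 1) * t powr (a + (real n / 2 + p))))" for c n
    by (rule has_bochner_integral_mult_right) (rule B)
  have pos: "real n / 2 + p + 1 > 0" for n using p by (smt (verit) of_nat_0_le_iff divide_nonneg_nonneg)
  have v: "v n = Gamma a * (rGamma (real n / 2 + (p + a) + 1) * t powr (real n / 2 + (p + a)))" for n
  proof -
    have "Gamma (real n / 2 + p + 1) \<noteq> 0"
      using pos[of n] by (metis Gamma_real_pos less_irrefl)
    thus ?thesis unfolding v_def Beta_def
      by (simp add: rGamma_inverse_Gamma field_simps)
  qed
  have v0: "v n \<ge> 0" for n
    using pos[of n] a unfolding v_def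
    by (intro mult_nonneg_nonneg) (auto simp: rGamma_inverse_Gamma Beta_def Gamma_real_nonneg add_nonneg_nonneg less_imp_le)
  have rG: "rGamma (real n / 2 + p + 1) \<ge> 0" for n
    using pos[of n] by (simp add: rGamma_inverse_Gamma Gamma_real_nonneg less_imp_le)
  have Bf: "has_bochner_integral lborel (f n) (fps_nth C n * v n)" for n
    using Bc[of "fps_nth C n * rGamma (real n / 2 + p + 1)" n]
    unfolding f_def v_def by (simp add: mult_ac)
  have normf: "norm (f n s) = \<bar>fps_nth C n\<bar> * rGamma (real n / 2 + p + 1) *
      (indicator {0<..<t} s * ((t - s) powr (a - 1) * s powr (real n / 2 + p)))" for n s
    unfolding f_def using rG[of n] by (simp add: abs_mult)
  \<comment> \<open>Everything but the coefficient is nonnegative, so the integrals of the norms are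
    the absolute values of the terms of the target series. Their summability permits exchanging sum
    and integral.\<close>
  have Bn: "has_bochner_integral lborel (\<lambda>s. norm (f n s)) \<bar>fps_nth C n * v n\<bar>" for n
  proof -
    have "\<bar>fps_nth C n * v n\<bar> = \<bar>fps_nth C n\<bar> * rGamma (real n / 2 + p + 1) *
        (Beta a (real n / 2 + p + 1) * t powr (a + (real n / 2 + p)))"
      using v0[of n] by (simp add: abs_mult) (simp add: v_def)
    thus ?thesis
      unfolding normf using Bc[of "\<bar>fps_nth C n\<bar> * rGamma (real n / 2 + p + 1)" n] by simp
  qed
  have sv: "(\<lambda>n. fps_nth C n * v n) sums (Gamma a * half_series C (p + a) t)"
    using sums_mult[OF half_series_sums[OF C t, of "p + a"], of "Gamma a"]
    unfolding v by (simp add: mult_ac)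
  have sa: "summable (\<lambda>n. \<bar>fps_nth C n * v n\<bar>)"
    using summable_mult[OF summable_half_series[OF C t, of "p + a"], of "\<bar>Gamma a\<bar>"]
    unfolding v by (simp add: abs_mult mult_ac)
  have sumf: "(\<lambda>n. f n s) sums (indicator {0<..<t} s * ((t - s) powr (a - 1) * half_series C p s))"
    for s
  proof (cases "s \<in> {0<..<t}")
    case True
    hence "s > 0" by simp
    from sums_mult[OF half_series_sums[OF C this, of p], of "(t - s) powr (a - 1)"]
    show ?thesis unfolding f_def using True by (simp add: mult_ac)
  qed (simp add: f_def)
  have sumabs: "summable (\<lambda>n. norm (f n s))" for s
  proof (cases "s \<in> {0<..<t}")
    case True
    hence "s > 0" by simp
    from summable_mult[OF summable_half_series[OF C this, of p], of "(t - s) powr (a - 1)"]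
    show ?thesis unfolding f_def using True by (simp add: abs_mult mult_ac)
  qed (simp add: f_def)
  have int: "integrable lborel (f n)" for n
    using Bf[of n] by (simp add: has_bochner_integral_iff)
  have sint: "summable (\<lambda>n. \<integral>s. norm (f n s) \<partial>lborel)"
    using sa Bn by (simp add: has_bochner_integral_iff)
  have eq: "(\<lambda>s. \<Sum>n. f n s)
      = (\<lambda>s. indicator {0<..<t} s * ((t - s) powr (a - 1) * half_series C p s))"
    using sumf by (intro ext) (simp add: sums_iff)
  have "integrable lborel (\<lambda>s. \<Sum>n. f n s)"
    by (rule integrable_suminf[OF int AE_I2[OF sumabs] sint])
  moreover have "(\<lambda>n. integral\<^sup>L lborel (f n)) sums (\<integral>s. (\<Sum>n. f n s) \<partial>lborel)"
    by (rule sums_integral[OF int AE_I2[OF sumabs] sint])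
  moreover have "integral\<^sup>L lborel (f n) = fps_nth C n * v n" for n
    using Bf[of n] by (simp add: has_bochner_integral_iff)
  ultimately show ?thesis
    unfolding eq has_bochner_integral_iff using sv by (simp add: sums_iff)
qed

section \<open>Linearity and leading terms\<close>

lemma half_series_add:
  assumes "fps_conv_radius C > 0" "fps_conv_radius D > 0" "t > 0"
  shows "half_series (C + D) p t = half_series C p t + half_series D p t"
  using sums_add[OF half_series_sums[OF assms(1,3), of p] half_series_sums[OF assms(2,3), of p]]
  unfolding half_series_def[of "C + D"] by (simp add: sums_iff algebra_simps)

lemma half_series_cmult:
  assumes "fps_conv_radius C > 0" "t > 0"
  shows "half_series (fps_const c * C) p t = c * half_series C p t"
  using sums_mult[OF half_series_sums[OF assms, of p], of c]
  unfolding half_series_def[of "fps_const c * C"] by (simp add: sums_iff algebra_simps)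

lemma half_series_0 [simp]: "half_series 0 p t = 0"
  by (simp add: half_series_def)

lemma half_series_1:
  assumes "t > 0"
  shows "half_series 1 0 t = 1"
  using assms unfolding half_series_def
  by (subst suminf_finite[of "{0}"]) (auto simp: rGamma_inverse_Gamma)

lemma half_series_const:
  assumes "t > 0"
  shows "half_series (fps_const c) 0 t = c"
  using half_series_cmult[of 1 t c 0] half_series_1[OF assms] assms by simp

lemma fps_conv_radius_pos_add:
  fixes C D :: "real fps"
  assumes "fps_conv_radius C > 0" "fps_conv_radius D > 0"
  shows "fps_conv_radius (C + D) > 0"
  by (rule less_le_trans[OF _ fps_conv_radius_add]) (use assms in simp)

lemma fps_conv_radius_pos_mult:
  fixes C D :: "real fps"
  assumes "fps_conv_radius C > 0" "fps_conv_radius D > 0"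
  shows "fps_conv_radius (C * D) > 0"
  by (rule less_le_trans[OF _ fps_conv_radius_mult]) (use assms in simp)

lemma half_series_sum:
  assumes "finite A" "t > 0" "\<And>j. j \<in> A \<Longrightarrow> fps_conv_radius (C j) > 0"
  shows "fps_conv_radius (\<Sum>j\<in>A. fps_const (w j) * C j) > 0"
    and "half_series (\<Sum>j\<in>A. fps_const (w j) * C j) p t = (\<Sum>j\<in>A. w j * half_series (C j) p t)"
proof -
  \<comment> \<open>Additivity requires a positive radius for the partial sum, so both claims share
    one induction.\<close>
  have "fps_conv_radius (\<Sum>j\<in>A. fps_const (w j) * C j) > 0 \<and>
    half_series (\<Sum>j\<in>A. fps_const (w j) * C j) p t = (\<Sum>j\<in>A. w j * half_series (C j) p t)"
    using assms(1,3)
  proof (induction A rule: finite_induct)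
    case (insert j A)
    have "fps_conv_radius (fps_const (w j) * C j) > 0"
      using insert by (intro fps_conv_radius_pos_mult) auto
    thus ?case
      using insert assms(2)
      by (auto simp: half_series_add half_series_cmult intro!: fps_conv_radius_pos_add)
  qed auto
  thus "fps_conv_radius (\<Sum>j\<in>A. fps_const (w j) * C j) > 0"
    and "half_series (\<Sum>j\<in>A. fps_const (w j) * C j) p t = (\<Sum>j\<in>A. w j * half_series (C j) p t)"
    by auto
qed

text \<open>In contrast to \<open>half_series_shift\<close>, the leading term is kept: for
  \<open>p = - 1 / 2\<close> it is the source of the singular term
  \<open>1 / sqrt (pi * t)\<close>.\<close>

lemma half_series_split_first:
  assumes C: "fps_conv_radius C > 0" and t: "t > 0"
  shows "half_series C p t =
    fps_nth C 0 * rGamma (p + 1) * t powr p + half_series (fps_shift 1 C) (p + 1 / 2) t"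
  using suminf_split_initial_segment[OF sums_summable[OF half_series_sums[OF C t, of p]], of 1]
  unfolding half_series_def by (simp add: add_divide_distrib add_ac)

section \<open>Ordinary and Caputo derivatives of half-integer power series\<close>

lemma higher_deriv_half_series:
  assumes C: "fps_conv_radius C > 0" and u: "\<And>t. t > 0 \<Longrightarrow> u t = half_series C p t" and t: "t > 0"
  shows "(deriv ^^ r) u t = half_series C (p - real r) t"
    and "(deriv ^^ r) u differentiable (at t)"
proof -
  \<comment> \<open>Equality on all positive reals, hence near \<open>t\<close>, is what allows the
    next derivative to be taken.\<close>
  have D: "((deriv ^^ r) u has_real_derivative half_series C (p - real (Suc r)) t) (at t)"
    if t: "t > 0" and eq: "\<And>t. t > 0 \<Longrightarrow> (deriv ^^ r) u t = half_series C (p - real r) t" for r t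
  proof (rule DERIV_cong_ev[THEN iffD1, rotated -1, OF _ refl _ refl])
    show "(half_series C (p - real r) has_real_derivative half_series C (p - real (Suc r)) t) (at t)"
      using DERIV_half_series[OF C t, of "p - real r"] by (simp add: algebra_simps)
    show "\<forall>\<^sub>F y in nhds t. half_series C (p - real r) y = (deriv ^^ r) u y"
      using eventually_nhds_in_open[of "{0<..}" t] t by (auto elim!: eventually_mono simp: eq)
  qed
  have eq: "(deriv ^^ r) u t = half_series C (p - real r) t" if "t > 0" for r t
    using that
  proof (induction r arbitrary: t)
    case 0
    thus ?case using u by simp
  next
    case (Suc r)
    show ?case using D[OF Suc.prems Suc.IH] by (simp add: DERIV_imp_deriv)
  qed
  show "(deriv ^^ r) u t = half_series C (p - real r) t" by (rule eq[OF t])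
  show "(deriv ^^ r) u differentiable (at t)"
    using D[OF t eq] by (auto simp: real_differentiable_def)
qed

text \<open>
  The coefficients assumed to vanish belong to the powers \<open>t\<^sup>n\<^sup>/\<^sup>2\<close> whose inner derivative is not
  integrable at \<open>0\<close>.
\<close>

lemma caputo_half_series:
  assumes C: "fps_conv_radius C > 0" and u: "\<And>t. t > 0 \<Longrightarrow> u t = half_series C 0 t" and t: "t > 0"
    and i: "i \<ge> 1" and odd: "\<And>n. odd n \<Longrightarrow> n + 1 < i \<Longrightarrow> fps_nth C n = 0"
  shows "caputo_differentiable (real i / 2) u t"
    and "caputo (real i / 2) u t =
           half_series (fps_shift i C) 0 t +
           (if even i then fps_nth C (i - 1) / sqrt (pi * t) else 0)"
proof -
  define m where "m = (i + 1) div 2"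
  \<comment> \<open>After \<open>m\<close> derivatives the term of index \<open>n\<close> has
    exponent \<open>n / 2 - m\<close>; index \<open>2 * m - 1\<close> lands at
    \<open>- 1 / 2\<close>, the lowest multiple of 1/2 that is integrable at 0.\<close>
  define D where "D = fps_shift (2 * m - 1) C"
  have m1: "m \<ge> 1" using i by (simp add: m_def)
  have ceil: "nat \<lceil>real i / 2\<rceil> = m"
    unfolding m_def by (cases "even i"; elim evenE oddE) (auto simp: ceiling_unique nat_eq_iff intro!: ceiling_unique)
  have D: "fps_conv_radius D > 0" using C by (simp add: D_def)
  have deriv_m: "(deriv ^^ m) u s = half_series D (- 1 / 2) s" if s: "s > 0" for s
  proof -
    \<comment> \<open>Below that index, even \<open>n\<close> belong to integer powers annihilated
      by \<open>m\<close> derivatives, and odd \<open>n\<close> have zero coefficients by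
      assumption.\<close>
    have "fps_nth C n * rGamma (real n / 2 + (- real m) + 1) = 0" if "n < 2 * m - 1" for n
    proof (cases "even n")
      case True
      then obtain l where l: "n = 2 * l" by auto
      have "real n / 2 + (- real m) + 1 = - real (m - l - 1)"
        using l that m1 by (simp add: of_nat_diff)
      thus ?thesis by (metis mult_zero_right rGamma_eq_zero_iff minus_of_nat_in_nonpos_Ints)
    next
      case False
      have "n + 1 < i" using that False unfolding m_def by presburger
      thus ?thesis using odd[OF False] by simp
    qed
    from half_series_shift[OF C s this]
    have "half_series C (- real m) s = half_series D (- real m + real (2 * m - 1) / 2) s"
      by (simp add: D_def)
    moreover have "- real m + real (2 * m - 1) / 2 = - 1 / 2"
      using m1 by (simp add: of_nat_diff field_simps)
    moreover have "(deriv ^^ m) u s = half_series C (- real m) s"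
      using higher_deriv_half_series(1)[OF C u s, of m] by simp
    ultimately show ?thesis by metis
  qed
  have diff: "\<forall>r<m. \<forall>s\<in>{0<..t}. (deriv ^^ r) u differentiable (at s)"
    using higher_deriv_half_series(2)[OF C u] by auto
  have "caputo_differentiable (real i / 2) u t \<and> caputo (real i / 2) u t =
           half_series (fps_shift i C) 0 t +
           (if even i then fps_nth C (i - 1) / sqrt (pi * t) else 0)"
  proof (cases "even i")
    case True
    \<comment> \<open>Here the order is the integer \<open>m\<close>, so no integral follows and the
      exponent \<open>- 1 / 2\<close> survives, with factor
      \<open>1 / Gamma (1 / 2)\<close>.\<close>
    hence im: "i = 2 * m" by (auto simp: m_def)
    hence nu: "real i / 2 = real m" by simp
    have "fps_shift 1 D = fps_shift i C"
      unfolding D_def fps_shift_fps_shift[symmetric] using im m1 by simp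
    moreover have "fps_nth D 0 = fps_nth C (i - 1)" by (simp add: D_def im)
    moreover have "rGamma (1 / 2) * t powr (- 1 / 2) = 1 / sqrt (pi * t)"
      using t by (simp add: rGamma_inverse_Gamma Gamma_one_half_real powr_minus powr_half_sqrt
          real_sqrt_mult field_simps)
    ultimately have "(deriv ^^ m) u t =
        fps_nth C (i - 1) / sqrt (pi * t) + half_series (fps_shift i C) 0 t"
      unfolding deriv_m[OF t] half_series_split_first[OF D t, of "- 1 / 2"]
      by (simp add: mult.assoc)
    thus ?thesis
      using True diff unfolding caputo_def caputo_differentiable_def Let_def ceil by (simp add: nu)
  next
    case False
    \<comment> \<open>Here an integral of order 1/2 lifts the exponent \<open>- 1 / 2\<close> to 0,
      leaving no singular term.\<close>
    hence im: "i = 2 * m - 1" using i unfolding m_def by presburger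
    hence nu: "real i / 2 = real m - 1 / 2" using m1 by (simp add: of_nat_diff field_simps)
    have Di: "D = fps_shift i C" by (simp add: D_def im)
    have "has_bochner_integral lborel
           (\<lambda>s. indicator {0<..<t} s * ((t - s) powr (1 / 2 - 1) * half_series D (- 1 / 2) s))
           (Gamma (1 / 2) * half_series D (- 1 / 2 + 1 / 2) t)"
      by (rule has_bochner_integral_half_series[OF D t]) auto
    also have "(\<lambda>s. indicator {0<..<t} s * ((t - s) powr (1 / 2 - 1) * half_series D (- 1 / 2) s))
        = (\<lambda>s. indicator {0<..<t} s *\<^sub>R caputo_integrand (real i / 2) u t s)"
    proof
      fix s
      show "indicator {0<..<t} s * ((t - s) powr (1 / 2 - 1) * half_series D (- 1 / 2) s)
        = indicator {0<..<t} s *\<^sub>R caputo_integrand (real i / 2) u t s"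
      proof (cases "s \<in> {0<..<t}")
        case True
        thus ?thesis
          unfolding caputo_integrand_def Let_def ceil unfolding nu
          by (simp add: deriv_m powr_minus_divide)
      qed simp
    qed
    finally have hb: "set_integrable lborel {0<..<t} (caputo_integrand (real i / 2) u t)"
      "(LBINT s:{0<..<t}. caputo_integrand (real i / 2) u t s) = Gamma (1 / 2) * half_series D 0 t"
      by (simp_all add: has_bochner_integral_iff set_integrable_def set_lebesgue_integral_def)
    show ?thesis
      using False diff hb unfolding caputo_def caputo_differentiable_def Let_def ceil
      by (simp add: nu Di Gamma_one_half_real)
  qed
  thus "caputo_differentiable (real i / 2) u t"
    and "caputo (real i / 2) u t =
           half_series (fps_shift i C) 0 t +
           (if even i then fps_nth C (i - 1) / sqrt (pi * t) else 0)"
    by auto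
qed

section \<open>Rearrangement of double series\<close>

text \<open>Absolute summability along antidiagonals gives unconditional summability of the whole
  family. The bijection sending \<open>(l, j)\<close> to \<open>(l + j, l)\<close> and Fubini for
  \<open>infsum\<close> then identify the two iterated sums.\<close>

lemma suminf_antidiagonal:
  fixes f :: "nat \<Rightarrow> nat \<Rightarrow> real"
  assumes "summable (\<lambda>n. \<Sum>i\<le>n. \<bar>f i (n - i)\<bar>)"
  shows "summable (f l)"
    and "(\<Sum>l. \<Sum>j. f l j) = (\<Sum>n. \<Sum>i\<le>n. f i (n - i))"
proof -
  define g where "g = (\<lambda>(n, i). f i (n - i))"
  define S where "S = (SIGMA n:UNIV. {..n::nat})"
  have "(\<lambda>p. \<bar>g p\<bar>) summable_on S"
    unfolding S_def
  proof (rule summable_on_SigmaI)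
    show "((\<lambda>i. \<bar>g (n, i)\<bar>) has_sum (\<Sum>i\<le>n. \<bar>f i (n - i)\<bar>)) {..n}" for n
      unfolding g_def by (simp add: has_sum_finite)
    show "(\<lambda>n. \<Sum>i\<le>n. \<bar>f i (n - i)\<bar>) summable_on UNIV"
      using assms by (intro norm_summable_imp_summable_on) (simp add: sum_nonneg)
  qed auto
  hence gS: "g summable_on S"
    using abs_summable_summable[of g S] by simp
  have bij: "bij_betw (\<lambda>(l, j). (l + j, l)) (UNIV \<times> UNIV) S"
    by (rule bij_betwI[of _ _ _ "\<lambda>(n, i). (i, n - i)"]) (auto simp: S_def)
  have gf: "(\<lambda>p. g (case p of (l, j) \<Rightarrow> (l + j, l))) = (\<lambda>(l, j). f l j)"
    by (auto simp: g_def)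
  have fU: "(\<lambda>(l, j). f l j) summable_on (UNIV \<times> UNIV)"
    using summable_on_reindex_bij_betw[OF bij, of g] gS unfolding gf by simp
  have fl: "f l summable_on UNIV" for l
    by (rule summable_on_SigmaD1[OF fU]) simp
  show "summable (f l)" using has_sum_imp_sums[OF has_sum_infsum[OF fl]] by (rule sums_summable)
  have "(\<Sum>l. \<Sum>j. f l j) = (\<Sum>l. infsum (f l) UNIV)"
    using has_sum_imp_sums[OF has_sum_infsum[OF fl]] by (simp add: sums_iff)
  also have "\<dots> = infsum (\<lambda>l. infsum (f l) UNIV) UNIV"
    using has_sum_imp_sums[OF has_sum_infsum[OF summable_on_Sigma_banach[OF fU]]] by (simp add: sums_iff)
  also have "\<dots> = infsum (\<lambda>(l, j). f l j) (UNIV \<times> UNIV)"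
    by (rule infsum_Sigma'_banach[OF fU])
  also have "\<dots> = infsum g S"
    using infsum_reindex_bij_betw[OF bij, of g] unfolding gf .
  also have "\<dots> = infsum (\<lambda>n. infsum (\<lambda>i. g (n, i)) {..n}) UNIV"
    using infsum_Sigma_banach[of g UNIV "\<lambda>n. {..n}"] gS unfolding S_def by simp
  also have "\<dots> = infsum (\<lambda>n. \<Sum>i\<le>n. f i (n - i)) UNIV"
    by (simp add: g_def)
  also have "\<dots> = (\<Sum>n. \<Sum>i\<le>n. f i (n - i))"
  proof -
    have "(\<lambda>n. \<Sum>i\<le>n. f i (n - i)) summable_on UNIV"
    proof (rule norm_summable_imp_summable_on, rule summable_comparison_test'[OF assms])
      show "norm (norm (\<Sum>i\<le>n. f i (n - i))) \<le> (\<Sum>i\<le>n. \<bar>f i (n - i)\<bar>)" for n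
        by (simp add: sum_abs)
    qed
    from has_sum_imp_sums[OF has_sum_infsum[OF this]] show ?thesis by (simp add: sums_iff)
  qed
  finally show "(\<Sum>l. \<Sum>j. f l j) = (\<Sum>n. \<Sum>i\<le>n. f i (n - i))" .
qed

section \<open>The formal power series of the crossing probability\<close>

text \<open>Newton's series for the exponent \<open>- k\<close>, with rising factorials as in
  \<open>mittag_leffler\<close>; the sign of \<open>- c\<close> cancels that of the generalized
  binomial coefficient.\<close>

lemma inverse_one_minus_power_nth:
  fixes c :: real
  shows "fps_nth (inverse ((1 - fps_const c * fps_X) ^ k)) j = pochhammer (real k) j * c ^ j / fact j"
proof -
  have "- fps_const c * fps_X = fps_const (- c) * fps_X" by simp
  hence "fps_nth (inverse ((1 - fps_const c * fps_X) ^ k)) j = (- c) ^ j * (- real k gchoose j)"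
    unfolding one_minus_fps_X_const_neg_power by (simp only: fps_compose_linear) simp
  moreover have "(- c) ^ j * (- 1) ^ j = c ^ j" by (simp flip: power_mult_distrib)
  ultimately show ?thesis
    by (simp add: gbinomial_pochhammer mult.assoc[symmetric])
qed

text \<open>With these signs, positive parameters give nonnegative coefficients. The crossing
  probability uses \<open>- a\<close> and \<open>- m\<close>, and the positive parameters provide
  the majorant.\<close>

definition resolvent_fps :: "real \<Rightarrow> real \<Rightarrow> nat \<Rightarrow> real fps" where
  "resolvent_fps a m k = inverse (1 - fps_const a * fps_X) * inverse ((1 - fps_const m * fps_X) ^ k)"

lemma resolvent_fps_nth:
  "fps_nth (resolvent_fps a m k) n =
     (\<Sum>i\<le>n. a ^ i * (pochhammer (real k) (n - i) * m ^ (n - i) / fact (n - i)))"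
proof -
  have "fps_nth (inverse (1 - fps_const a * fps_X)) i = a ^ i" for i
    using inverse_one_minus_power_nth[of a 1 i] by (simp add: pochhammer_fact[symmetric])
  thus ?thesis
    unfolding resolvent_fps_def fps_mult_nth inverse_one_minus_power_nth atLeast0AtMost by simp
qed

lemma resolvent_fps_mult:
  "(1 - fps_const a * fps_X) * ((1 - fps_const m * fps_X) ^ k * resolvent_fps a m k) = 1"
proof -
  have "(1 - fps_const a * fps_X) * inverse (1 - fps_const a * fps_X) = 1"
    by (rule inverse_mult_eq_1') simp
  moreover have "(1 - fps_const m * fps_X) ^ k * inverse ((1 - fps_const m * fps_X) ^ k) = 1"
    by (rule inverse_mult_eq_1') (simp add: fps_nth_power_0)
  ultimately show ?thesis
    unfolding resolvent_fps_def by (metis (no_types, lifting) mult.left_commute mult.right_neutral)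
qed

lemma fps_conv_radius_resolvent_fps: "fps_conv_radius (resolvent_fps a m k) > 0"
proof -
  have "fps_conv_radius (inverse ((1 - fps_const c * fps_X) ^ n)) > 0" for c :: real and n
  proof (rule fps_conv_radius_inverse_pos)
    have "fps_conv_radius (1 + fps_const (- c) * fps_X) > 0"
      by (intro fps_conv_radius_pos_add fps_conv_radius_pos_mult) auto
    hence "fps_conv_radius (1 - fps_const c * fps_X) > 0" by (simp flip: fps_const_neg)
    thus "fps_conv_radius ((1 - fps_const c * fps_X) ^ n) > 0"
      by (rule less_le_trans[OF _ fps_conv_radius_power])
  qed (simp add: fps_nth_power_0)
  from this[of a 1] this[of m k] show ?thesis
    unfolding resolvent_fps_def by (intro fps_conv_radius_pos_mult) simp_all
qed

definition psi_fps :: "real \<Rightarrow> real \<Rightarrow> nat \<Rightarrow> real fps" where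
  "psi_fps a m k = 1 - fps_const (m ^ k) * (fps_X ^ k * resolvent_fps (- a) (- m) k)"

text \<open>The resolvent has constant coefficient 1 and enters multiplied by the
  \<open>k\<close>-th power of \<open>fps_X\<close>. The resulting gap between 0 and
  \<open>k\<close> yields both the existence of the Caputo derivatives and the initial
  conditions.\<close>

lemma psi_fps_nth:
  assumes "k \<ge> 1"
  shows "fps_nth (psi_fps a m k) 0 = 1"
    and "0 < n \<Longrightarrow> n < k \<Longrightarrow> fps_nth (psi_fps a m k) n = 0"
    and "fps_nth (psi_fps a m k) k = - (m ^ k)"
  using assms by (auto simp: psi_fps_def fps_X_power_mult_nth resolvent_fps_nth)

lemma fps_conv_radius_psi_fps: "fps_conv_radius (psi_fps a m k) > 0"
proof -
  have "fps_conv_radius (1 + fps_const (- (m ^ k)) * (fps_X ^ k * resolvent_fps (- a) (- m) k)) > 0"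
    by (intro fps_conv_radius_pos_add fps_conv_radius_pos_mult fps_conv_radius_resolvent_fps) auto
  thus ?thesis by (simp add: psi_fps_def flip: fps_const_neg)
qed

text \<open>The Gamma argument \<open>j / 2 + (l + k) / 2 + 1\<close> depends on
  \<open>l + j\<close> only, so on each antidiagonal it factors out and the rest is a coefficient of
  the resolvent.\<close>

lemma psi_el_eq_half_series:
  assumes lam: "lam > 0" and al: "\<alpha> > 0" and t: "t > 0"
  shows "psi_el lam \<alpha> k t = half_series (psi_fps (\<alpha> / sqrt 2) (lam / sqrt 2) k) 0 t"
proof -
  define a m x where "a = \<alpha> / sqrt 2" and "m = lam / sqrt 2" and "x = sqrt t"
  define Q where "Q = resolvent_fps (- a) (- m) k"
  have pos: "a > 0" "m > 0" "x > 0" using assms by (auto simp: a_def m_def x_def)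
  define f where "f l j = (- (a * x)) ^ l * (pochhammer (real k) j * (- (m * x)) ^ j /
      (fact j * Gamma (1 / 2 * real j + (real (l + k) / 2 + 1))))" for l j
  have poch: "pochhammer (real k) j \<ge> 0" for j
    by (metis pochhammer_of_nat of_nat_0_le_iff)
  have fQ: "f i (n - i) = (- a) ^ i * (pochhammer (real k) (n - i) * (- m) ^ (n - i) / fact (n - i))
      * (rGamma (real n / 2 + (real k / 2 + 1)) * x ^ n)" if "i \<le> n" for i n
  proof -
    have "1 / 2 * real (n - i) + (real (i + k) / 2 + 1) = real n / 2 + (real k / 2 + 1)"
      using that by (simp add: of_nat_diff field_simps)
    moreover have "x ^ n = x ^ i * x ^ (n - i)"
      using that by (simp flip: power_add)
    moreover have "(- (a * x)) ^ i = (- a) ^ i * x ^ i" "(- (m * x)) ^ (n - i) = (- m) ^ (n - i) * x ^ (n - i)"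
      by (simp_all flip: power_mult_distrib)
    ultimately show ?thesis
      unfolding f_def by (simp only: rGamma_inverse_Gamma) (simp add: field_simps)
  qed
  \<comment> \<open>Absolute values turn \<open>- a\<close> and \<open>- m\<close> into
    \<open>a\<close> and \<open>m\<close>, so the majorant is again a resolvent series.\<close>
  have "\<bar>f i (n - i)\<bar> = a ^ i * (pochhammer (real k) (n - i) * m ^ (n - i) / fact (n - i))
      * (\<bar>rGamma (real n / 2 + (real k / 2 + 1))\<bar> * x ^ n)" if "i \<le> n" for i n
    unfolding fQ[OF that] using pos poch by (simp add: abs_mult power_abs)
  hence "(\<lambda>n. \<Sum>i\<le>n. \<bar>f i (n - i)\<bar>) = (\<lambda>n. fps_nth (resolvent_fps a m k) n *
      (\<bar>rGamma (real n / 2 + (real k / 2 + 1))\<bar> * x ^ n))"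
    by (simp add: resolvent_fps_nth sum_distrib_right)
  also have "\<dots> = (\<lambda>n. \<bar>fps_nth (resolvent_fps a m k) n *
      rGamma (real n / 2 + (real k / 2 + 1)) * x ^ n\<bar>)"
  proof -
    have "fps_nth (resolvent_fps a m k) n \<ge> 0" for n
      unfolding resolvent_fps_nth using pos
      by (intro sum_nonneg mult_nonneg_nonneg divide_nonneg_nonneg poch) auto
    thus ?thesis using pos by (simp add: abs_mult mult.assoc)
  qed
  finally have sm: "summable (\<lambda>n. \<Sum>i\<le>n. \<bar>f i (n - i)\<bar>)"
    using summable_fps_rGamma_half[OF fps_conv_radius_resolvent_fps] by simp
  have "(- (a * x)) ^ l * mittag_leffler (real k) (1 / 2) (real (l + k) / 2 + 1) (- (m * x))
      = (\<Sum>j. f l j)" for l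
  proof -
    define h where "h j = pochhammer (real k) j * (- (m * x)) ^ j /
      (fact j * Gamma (1 / 2 * real j + (real (l + k) / 2 + 1)))" for j
    have f: "f l = (\<lambda>j. (- (a * x)) ^ l * h j)" by (auto simp: f_def h_def)
    \<comment> \<open>Summability is known for the product \<open>f l\<close> only; dividing by the
      nonzero factor gives it for the Mittag-Leffler series \<open>h\<close>.\<close>
    have "(- (a * x)) ^ l \<noteq> 0" using pos by simp
    hence "summable h"
      using suminf_antidiagonal(1)[OF sm, of l] unfolding f by (simp only: summable_cmult_iff) simp
    thus ?thesis
      unfolding mittag_leffler_def h_def[symmetric] f by (rule suminf_mult[symmetric])
  qed
  hence "psi_el lam \<alpha> k t = 1 - (m * x) ^ k * (\<Sum>l. \<Sum>j. f l j)"
    unfolding psi_el_def by (simp add: a_def m_def x_def)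
  also have "(\<Sum>l. \<Sum>j. f l j) = (\<Sum>n. \<Sum>i\<le>n. f i (n - i))"
    by (rule suminf_antidiagonal(2)[OF sm])
  also have "\<dots> = (\<Sum>n. fps_nth Q n * rGamma (real n / 2 + real k / 2 + 1) * x ^ n)"
    unfolding Q_def resolvent_fps_nth sum_distrib_right
    by (intro suminf_cong sum.cong) (simp_all add: fQ add_ac mult_ac)
  also have "(m * x) ^ k * \<dots> = m ^ k * half_series Q (real k / 2) t"
  proof -
    have "x ^ k = t powr (real k / 2)"
      using powr_half_nat_add[OF t, of k 0] t by (simp add: x_def)
    thus ?thesis
      by (simp add: half_series_eq_power_series[OF _ t] Q_def fps_conv_radius_resolvent_fps
          power_mult_distrib x_def)
  qed
  \<comment> \<open>The power \<open>k / 2\<close> of \<open>t\<close> is absorbed into the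
    coefficients, so that the exponent offset becomes 0.\<close>
  also have "half_series Q (real k / 2) t = half_series (fps_X ^ k * Q) 0 t"
  proof -
    have "fps_conv_radius (fps_X ^ k * Q) > 0"
      unfolding Q_def by (intro fps_conv_radius_pos_mult fps_conv_radius_resolvent_fps) auto
    hence "half_series (fps_X ^ k * Q) 0 t = half_series (fps_shift k (fps_X ^ k * Q)) (0 + real k / 2) t"
      using t by (rule half_series_shift) (simp add: fps_X_power_mult_nth)
    thus ?thesis by (simp add: mult.commute[of "fps_X ^ k"])
  qed
  also have "1 - m ^ k * half_series (fps_X ^ k * Q) 0 t = half_series (psi_fps a m k) 0 t"
  proof -
    have c: "fps_conv_radius (fps_X ^ k * Q) > 0"
      unfolding Q_def by (intro fps_conv_radius_pos_mult fps_conv_radius_resolvent_fps) auto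
    have "psi_fps a m k = 1 + fps_const (- (m ^ k)) * (fps_X ^ k * Q)"
      by (simp add: psi_fps_def Q_def flip: fps_const_neg)
    moreover have "half_series (1 + fps_const (- (m ^ k)) * (fps_X ^ k * Q)) 0 t =
        half_series 1 0 t + half_series (fps_const (- (m ^ k)) * (fps_X ^ k * Q)) 0 t"
      by (intro half_series_add t fps_conv_radius_pos_mult[OF _ c]) auto
    ultimately show ?thesis
      unfolding half_series_cmult[OF c t] by (simp add: half_series_1[OF t])
  qed
  finally show ?thesis by (simp add: a_def m_def)
qed

section \<open>The fractional equation as an identity of formal power series\<close>

text \<open>With \<open>U\<close> the second sum and \<open>V\<close> the first, the binomial
  theorem gives \<open>U = 1 - 1 / (1 + a X)\<close>, that is \<open>(1 + a X) U = a X\<close>. As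
  \<open>X V = U\<close>, this reads \<open>X (V + a U) = a X\<close>, and \<open>X\<close>
  cancels.\<close>

lemma psi_fps_identity:
  fixes a m :: real
  assumes m: "m > 0" and k: "k \<ge> 1"
  defines "w \<equiv> \<lambda>j. real (k choose j) * (1 / m) ^ j"
  shows "(\<Sum>j=0..k. fps_const (w j) * fps_shift (Suc j) (psi_fps a m k)) +
         fps_const a * (\<Sum>j=0..k. fps_const (w j) * fps_shift j (psi_fps a m k)) = fps_const a"
proof -
  define P where "P = psi_fps a m k"
  define Q where "Q = resolvent_fps (- a) (- m) k"
  define U where "U = (\<Sum>j=0..k. fps_const (w j) * fps_shift j P)"
  define V where "V = (\<Sum>j=0..k. fps_const (w j) * fps_shift (Suc j) P)"
  (* Multiplying by X turns the first sum into U, because the constant coefficients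
     of the shifts cancel against each other. *)
  have X: "fps_X * fps_shift (Suc j) P = fps_shift j P - fps_const (fps_nth P j)" for j
    by (rule fps_ext) (auto simp: gr0_conv_Suc)
  have "fps_X * V = (\<Sum>j=0..k. fps_const (w j) * (fps_X * fps_shift (Suc j) P))"
    unfolding V_def sum_distrib_left by (simp add: mult_ac)
  also have "\<dots> = U - fps_const (\<Sum>j=0..k. w j * fps_nth P j)"
  proof -
    have "(\<Sum>j=0..k. fps_const (w j * fps_nth P j)) = fps_const (\<Sum>j=0..k. w j * fps_nth P j)"
      by (rule fps_ext) (simp add: fps_sum_nth)
    thus ?thesis unfolding X U_def right_diff_distrib sum_subtractf by simp
  qed
  also have "(\<Sum>j=0..k. w j * fps_nth P j) = (\<Sum>j\<in>{0,k}. w j * fps_nth P j)"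
    using psi_fps_nth(2)[OF k] by (intro sum.mono_neutral_right) (auto simp: P_def)
  \<comment> \<open>Index 0 contributes 1 and index \<open>k\<close> contributes
    \<open>(1 / m) ^ k\<close> times \<open>- (m ^ k)\<close>, which is -1.\<close>
  also have "\<dots> = 0"
    using psi_fps_nth[OF k] m k by (simp add: P_def w_def power_one_over)
  finally have XV: "fps_X * V = U" by simp
  \<comment> \<open>Shifting by \<open>j\<close> lowers the power of \<open>fps_X\<close> to
    \<open>k - j\<close>, and the weight lowers that of \<open>m\<close> equally: this produces the
    terms of the expansion of \<open>(1 + m X) ^ k\<close>.\<close>
  have sh: "fps_const (w j) * fps_shift j P = (if j = 0 then 1 else 0) -
      of_nat (k choose j) * (fps_const m * fps_X) ^ (k - j) * Q" if "j \<le> k" for j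
  proof -
    have shift: "fps_shift j P = (if j = 0 then 1 else 0) - fps_const (m ^ k) * (fps_X ^ (k - j) * Q)"
      using that by (intro fps_ext)
        (auto simp: P_def psi_fps_def Q_def fps_X_power_mult_nth fps_mult_left_const_nth)
    have "w j * m ^ k = real (k choose j) * m ^ (k - j)"
      using that m unfolding w_def by (simp add: power_diff power_one_over)
    hence weight: "fps_const (w j) * fps_const (m ^ k) = of_nat (k choose j) * fps_const m ^ (k - j)"
      by (simp add: fps_of_nat[symmetric] fps_const_power)
    have "fps_const (w j) * fps_shift j P = fps_const (w j) * (if j = 0 then 1 else 0) -
        (fps_const (w j) * fps_const (m ^ k)) * (fps_X ^ (k - j) * Q)"
      unfolding shift right_diff_distrib by (simp only: mult.assoc)
    thus ?thesis
      unfolding weight by (simp add: power_mult_distrib w_def mult.assoc)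
  qed
  have "U = 1 - (\<Sum>j\<le>k. of_nat (k choose j) * 1 ^ j * (fps_const m * fps_X) ^ (k - j)) * Q"
    unfolding U_def sum_distrib_right by (simp add: sh sum_subtractf atLeast0AtMost)
  also have "\<dots> = 1 - (1 - fps_const (- m) * fps_X) ^ k * Q"
    unfolding binomial_ring[symmetric] by (simp flip: fps_const_neg)
  finally have U: "U = \<dots>" .
  have "(1 - fps_const (- a) * fps_X) * U = (1 - fps_const (- a) * fps_X) - 1"
    unfolding U right_diff_distrib Q_def resolvent_fps_mult by simp
  hence "fps_X * (V + fps_const a * U) = fps_X * fps_const a"
    by (simp add: XV algebra_simps flip: fps_const_neg)
  thus ?thesis by (simp add: U_def V_def P_def)
qed

section \<open>The fractional equation and the initial conditions\<close>

theorem theorem2p6: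
  fixes lam \<alpha> :: real and k :: nat
  assumes "lam > 0" and "\<alpha> > 0" and "k \<ge> 1"
  shows
    "(\<forall>t>0.
        (\<forall>j\<in>{0..k}. caputo_differentiable (real j / 2 + 1 / 2) (psi_el lam \<alpha> k) t) \<and>
        (\<forall>j\<in>{1..k}. caputo_differentiable (real j / 2) (psi_el lam \<alpha> k) t) \<and>
        (\<Sum>j=0..k. real (k choose j) * (sqrt 2 / lam) ^ j *
             caputo (real j / 2 + 1 / 2) (psi_el lam \<alpha> k) t)
        + \<alpha> / sqrt 2 * (\<Sum>j=1..k. real (k choose j) * (sqrt 2 / lam) ^ j *
             caputo (real j / 2) (psi_el lam \<alpha> k) t)
        = \<alpha> / sqrt 2 * (1 - psi_el lam \<alpha> k t)
          - (if odd k then 1 else 0) / sqrt (pi * t))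
     \<and> (psi_el lam \<alpha> k \<longlongrightarrow> 1) (at_right 0)
     \<and> (odd k \<and> k > 1 \<longrightarrow>
          (\<forall>r\<in>{1..(k - 1) div 2}. ((deriv ^^ r) (psi_el lam \<alpha> k) \<longlongrightarrow> 0) (at_right 0)))
     \<and> (even k \<and> k > 1 \<longrightarrow>
          (\<forall>r\<in>{1..k div 2 - 1}. ((deriv ^^ r) (psi_el lam \<alpha> k) \<longlongrightarrow> 0) (at_right 0)))"
proof -
  define a m where "a = \<alpha> / sqrt 2" and "m = lam / sqrt 2"
  define P where "P = psi_fps a m k"
  define u where "u = psi_el lam \<alpha> k"
  define w where "w j = real (k choose j) * (sqrt 2 / lam) ^ j" for j
  have m: "m > 0" using assms by (simp add: m_def)
  have w: "w j = real (k choose j) * (1 / m) ^ j" for j by (simp add: w_def m_def)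
  have P: "fps_conv_radius P > 0" unfolding P_def by (rule fps_conv_radius_psi_fps)
  have u: "u t = half_series P 0 t" if "t > 0" for t
    unfolding u_def P_def a_def m_def by (rule psi_el_eq_half_series[OF assms(1,2) that])
  note Pnth = psi_fps_nth[OF assms(3), where a = a and m = m, folded P_def]
  \<comment> \<open>The highest order is \<open>Suc k / 2\<close>, so the odd indices in question
    lie strictly between 0 and \<open>k\<close>.\<close>
  have vanish: "fps_nth P n = 0" if "odd n" "n + 1 < i" "i \<le> Suc k" for n i
    using that by (intro Pnth(2)) (auto intro: Nat.gr0I)
  have eqn: "(\<forall>j\<in>{0..k}. caputo_differentiable (real j / 2 + 1 / 2) u t) \<and>
      (\<forall>j\<in>{1..k}. caputo_differentiable (real j / 2) u t) \<and>
      (\<Sum>j=0..k. w j * caputo (real j / 2 + 1 / 2) u t) + a * (\<Sum>j=1..k. w j * caputo (real j / 2) u t)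
        = a * (1 - u t) - (if odd k then 1 else 0) / sqrt (pi * t)" if t: "t > 0" for t
  proof (intro conjI ballI)
    note cap = caputo_half_series[OF P u t _ vanish]
    have half: "real j / 2 + 1 / 2 = real (Suc j) / 2" for j by (simp add: field_simps)
    show "caputo_differentiable (real j / 2 + 1 / 2) u t" if "j \<in> {0..k}" for j
      unfolding half by (rule cap(1)) (use that in auto)
    show "caputo_differentiable (real j / 2) u t" if "j \<in> {1..k}" for j
      by (rule cap(1)) (use that in auto)
    let ?h = "\<lambda>i. half_series (fps_shift i P) 0 t"
    have c1: "caputo (real j / 2 + 1 / 2) u t =
        ?h (Suc j) + (if odd j then fps_nth P j / sqrt (pi * t) else 0)" if "j \<le> k" for j
      unfolding half by (subst cap(2)) (use that in auto)
    \<comment> \<open>For even \<open>j\<close> the singular term would have coefficient index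
      \<open>j - 1\<close>, which is odd and below \<open>k\<close>, so it vanishes.\<close>
    have c2: "caputo (real j / 2) u t = ?h j" if "j \<in> {1..k}" for j
    proof -
      have "even j \<Longrightarrow> fps_nth P (j - 1) = 0"
        using that by (intro Pnth(2)) (auto elim!: evenE)
      thus ?thesis by (subst cap(2)) (use that in auto)
    qed
    \<comment> \<open>Only \<open>j = k\<close> survives, where weight times coefficient is -1; this
      is the source of \<open>c_k\<close>.\<close>
    have "(\<Sum>j=0..k. w j * (if odd j then fps_nth P j / sqrt (pi * t) else 0)) =
        (\<Sum>j\<in>{k}. w j * (if odd j then fps_nth P j / sqrt (pi * t) else 0))"
      using Pnth(2) by (intro sum.mono_neutral_right) (auto elim!: oddE)
    also have "\<dots> = - ((if odd k then 1 else 0) / sqrt (pi * t))"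
      using m by (simp add: w Pnth(3) power_one_over)
    finally have s1: "(\<Sum>j=0..k. w j * caputo (real j / 2 + 1 / 2) u t) =
        (\<Sum>j=0..k. w j * ?h (Suc j)) - (if odd k then 1 else 0) / sqrt (pi * t)"
      by (simp add: c1 distrib_left sum.distrib)
    \<comment> \<open>The term \<open>j = 0\<close> missing from the second sum is
      \<open>u t\<close> itself, which accounts for \<open>1 - u t\<close> on the right-hand
      side.\<close>
    have "(\<Sum>j=0..k. w j * ?h j) = w 0 * ?h 0 + (\<Sum>j=1..k. w j * ?h j)"
      by (simp add: sum.atLeast_Suc_atMost)
    hence s2: "(\<Sum>j=1..k. w j * caputo (real j / 2) u t) = (\<Sum>j=0..k. w j * ?h j) - u t"
      by (simp add: c2 u[OF t] w_def)
    define U where "U = (\<Sum>j=0..k. fps_const (w j) * fps_shift j P)"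
    define V where "V = (\<Sum>j=0..k. fps_const (w j) * fps_shift (Suc j) P)"
    have U: "fps_conv_radius U > 0" "half_series U 0 t = (\<Sum>j=0..k. w j * ?h j)"
      unfolding U_def by (rule half_series_sum; use P t in simp)+
    have V: "fps_conv_radius V > 0" "half_series V 0 t = (\<Sum>j=0..k. w j * ?h (Suc j))"
      unfolding V_def by (rule half_series_sum; use P t in simp)+
    have "V + fps_const a * U = fps_const a"
      unfolding U_def V_def P_def w by (rule psi_fps_identity[OF m assms(3)])
    moreover have "half_series (V + fps_const a * U) 0 t = half_series V 0 t + a * half_series U 0 t"
      by (subst half_series_add) (use U V t in \<open>auto simp: half_series_cmult intro!: fps_conv_radius_pos_mult\<close>)
    ultimately have "half_series V 0 t + a * half_series U 0 t = a"
      by (simp add: half_series_const t)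
    thus "(\<Sum>j=0..k. w j * caputo (real j / 2 + 1 / 2) u t) + a * (\<Sum>j=1..k. w j * caputo (real j / 2) u t)
        = a * (1 - u t) - (if odd k then 1 else 0) / sqrt (pi * t)"
      unfolding s1 s2 U V by (simp add: algebra_simps)
  qed
  have lim0: "(u \<longlongrightarrow> 1) (at_right 0)"
  proof (rule Lim_transform_eventually)
    show "(half_series P 0 \<longlongrightarrow> 1) (at_right 0)"
      using tendsto_half_series_0[OF P, of 0] by (simp add: Pnth(1))
    show "\<forall>\<^sub>F t in at_right 0. half_series P 0 t = u t"
      by (rule eventually_at_right_less[THEN eventually_mono]) (simp add: u)
  qed
  \<comment> \<open>The constant 1 is removed by differentiation, and the next power present is
    \<open>k / 2\<close>, whose exponent stays positive after \<open>r\<close> derivatives. The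
    condition \<open>2 * r < k\<close> serves both parities.\<close>
  have limr: "((deriv ^^ r) u \<longlongrightarrow> 0) (at_right 0)" if r: "r \<ge> 1" "2 * r < k" for r
  proof (rule Lim_transform_eventually)
    have p: "real k / 2 - real r > 0" using r by linarith
    show "(half_series (fps_shift k P) (real k / 2 - real r) \<longlongrightarrow> 0) (at_right 0)"
      using tendsto_half_series_0[of "fps_shift k P" "real k / 2 - real r"] P p by simp
    have z: "fps_nth P n * rGamma (real n / 2 + (- real r) + 1) = 0" if "n < k" for n
    proof (cases "n = 0")
      case True
      have "real n / 2 + (- real r) + 1 = - real (r - 1)" using r True by (simp add: of_nat_diff)
      thus ?thesis by (metis mult_zero_right rGamma_eq_zero_iff minus_of_nat_in_nonpos_Ints)
    next
      case False
      thus ?thesis using Pnth(2)[of n] that by simp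
    qed
    have "(deriv ^^ r) u t = half_series (fps_shift k P) (real k / 2 - real r) t" if "t > 0" for t
      using higher_deriv_half_series(1)[OF P u that, of r] half_series_shift[OF P that z, of k]
      by simp
    thus "\<forall>\<^sub>F t in at_right 0. half_series (fps_shift k P) (real k / 2 - real r) t = (deriv ^^ r) u t"
      by (intro eventually_at_right_less[THEN eventually_mono]) simp
  qed
  have limr_odd: "((deriv ^^ r) u \<longlongrightarrow> 0) (at_right 0)" if "r \<in> {1..(k - 1) div 2}" for r
  proof (rule limr)
    show "2 * r < k" using that assms(3) by simp presburger
  qed (use that in simp)
  have limr_even: "((deriv ^^ r) u \<longlongrightarrow> 0) (at_right 0)" if "r \<in> {1..k div 2 - 1}" for r
  proof (rule limr)
    show "2 * r < k" using that by simp presburger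
  qed (use that in simp)
  show ?thesis
    unfolding u_def[symmetric] w_def[symmetric] a_def[symmetric]
    by (intro conjI impI allI ballI lim0 limr_odd limr_even eqn; assumption)
qed

end
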